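(* Let $(G,\tau)$ be a Hausdorff right topological group which is either compact, or $\sigma$-locally compact and admissible. Let $L\subset G$ be a $\sigma$-closed subgroup. Then: 1. $N(L)$ is a normal subgroup (of $L$) that is closed in $(L,\sigma)$; 2. $(L/N(L),\tau)=(L/N(L),\sigma)$, and this is a $\sigma$-compact Hausdorff topological group; 3. the map $G/N(L)\times L/N(L)\to G/N(L)$, $([x],[y])\mapsto[xy]$, is jointly continuous (with respect to the quotient topologies induced by $\tau$).
   Context: A right topological group is a group $G$ with a topology $\tau$ such that for every $x\in G$ the map $G\to G$, $g\mapsto gx$, is continuous. Its topological center is $\Lambda(G)=\{x\in G : g\mapsto xg \text{ is continuous}\}$; $G$ is admissible if $\Lambda(G)$ is dense in $G$. "$\sigma$-locally compact" means locally compact and $\sigma$-compact (a countable union of compact sets). The $\sigma$-topology on $G$ is the quotient topology on $G$ induced by the map $(G,\tau)\times(G,\tau)\to G$, $(x,y)\mapsto x^{-1}y$; "$\sigma$-closed" means closed in $(G,\sigma)$ (not to be confused with the adjective "$\sigma$-compact"). For a subgroup $L$ of $G$, $(L,\sigma)$ denotes $L$ with the subspace topology from $(G,\sigma)$, and $N(L)$ denotes the intersection of all closed neighbourhoods of $e$ in $(L,\sigma)$. For a subgroup $K$, quotients by $K$ are spaces of left cosets; $(L/N(L),\tau)$ and $(L/N(L),\sigma)$ are the quotient topologies induced by $(L,\tau)$ and $(L,\sigma)$. *)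

theory Defs
  imports "HOL-Analysis.Analysis" "HOL-Algebra.Left_Coset"
begin

definition quotient_topology :: "'a topology \<Rightarrow> ('a \<Rightarrow> 'b) \<Rightarrow> 'b topology" where
  "quotient_topology X f =
     topology (\<lambda>U. U \<subseteq> f ` topspace X \<and> openin X {x \<in> topspace X. f x \<in> U})"

lemma openin_quotient_topology:
  "openin (quotient_topology X f) U \<longleftrightarrow>
     U \<subseteq> f ` topspace X \<and> openin X {x \<in> topspace X. f x \<in> U}"
proof -
  have "istopology (\<lambda>U. U \<subseteq> f ` topspace X \<and> openin X {x \<in> topspace X. f x \<in> U})"
    unfolding istopology_def
  proof (intro conjI allI impI)
    fix S T
    assume "S \<subseteq> f ` topspace X \<and> openin X {x \<in> topspace X. f x \<in> S}"
      and "T \<subseteq> f ` topspace X \<and> openin X {x \<in> topspace X. f x \<in> T}"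
    moreover have "{x \<in> topspace X. f x \<in> S \<inter> T} =
        {x \<in> topspace X. f x \<in> S} \<inter> {x \<in> topspace X. f x \<in> T}" by auto
    ultimately show "S \<inter> T \<subseteq> f ` topspace X" "openin X {x \<in> topspace X. f x \<in> S \<inter> T}"
      by auto
  next
    fix \<K>
    assume *: "\<forall>K\<in>\<K>. K \<subseteq> f ` topspace X \<and> openin X {x \<in> topspace X. f x \<in> K}"
    then show "\<Union>\<K> \<subseteq> f ` topspace X" by blast
    have "{x \<in> topspace X. f x \<in> \<Union>\<K>} = (\<Union>K\<in>\<K>. {x \<in> topspace X. f x \<in> K})" by auto
    with * show "openin X {x \<in> topspace X. f x \<in> \<Union>\<K>}" by auto
  qed
  then show ?thesis
    by (simp add: quotient_topology_def topology_inverse')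
qed

lemma topspace_quotient_topology: "topspace (quotient_topology X f) = f ` topspace X"
proof -
  have "{x \<in> topspace X. f x \<in> f ` topspace X} = topspace X" by auto
  then have "openin (quotient_topology X f) (f ` topspace X)"
    by (simp add: openin_quotient_topology)
  then show ?thesis
    by (metis openin_quotient_topology openin_subset openin_topspace subset_antisym)
qed

lemma quotient_map_quotient_topology: "quotient_map X (quotient_topology X f) f"
  by (simp add: quotient_map_def openin_quotient_topology topspace_quotient_topology)

definition sigma_compact_space :: "'a topology \<Rightarrow> bool" where
  "sigma_compact_space X \<longleftrightarrow>
     (\<exists>\<K>. countable \<K> \<and> (\<forall>K\<in>\<K>. compactin X K) \<and> \<Union>\<K> = topspace X)"

locale right_topological_group = group G for G (structure) +
  fixes T :: "'a topology"
  assumes topspace_eq: "topspace T = carrier G"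
    and continuous_right_mult: "x \<in> carrier G \<Longrightarrow> continuous_map T T (\<lambda>g. g \<otimes> x)"

locale topological_group = group G for G (structure) +
  fixes T :: "'a topology"
  assumes topspace_eq: "topspace T = carrier G"
    and continuous_mult: "continuous_map (prod_topology T T) T (\<lambda>(x, y). x \<otimes> y)"
    and continuous_inv: "continuous_map T T (\<lambda>x. inv x)"

definition topological_center :: "('a, 'b) monoid_scheme \<Rightarrow> 'a topology \<Rightarrow> 'a set" where
  "topological_center G T = {x \<in> carrier G. continuous_map T T (\<lambda>g. x \<otimes>\<^bsub>G\<^esub> g)}"

definition admissible :: "('a, 'b) monoid_scheme \<Rightarrow> 'a topology \<Rightarrow> bool" where
  "admissible G T \<longleftrightarrow> T closure_of (topological_center G T) = topspace T"

definition sigma_topology :: "('a, 'b) monoid_scheme \<Rightarrow> 'a topology \<Rightarrow> 'a topology" where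
  "sigma_topology G T = quotient_topology (prod_topology T T) (\<lambda>(x, y). inv\<^bsub>G\<^esub> x \<otimes>\<^bsub>G\<^esub> y)"

definition N_sub :: "('a, 'b) monoid_scheme \<Rightarrow> 'a topology \<Rightarrow> 'a set \<Rightarrow> 'a set" where
  "N_sub G T L =
     (let S = subtopology (sigma_topology G T) L
      in \<Inter>{C. closedin S C \<and> \<one>\<^bsub>G\<^esub> \<in> S interior_of C})"

text \<open>The space of left cosets of \<open>K\<close> represented by points of \<open>X\<close>; here \<open>X\<close> is a topology on the
  whole group or on a subgroup containing \<open>K\<close>.\<close>

definition coset_topology ::
    "('a, 'b) monoid_scheme \<Rightarrow> 'a topology \<Rightarrow> 'a set \<Rightarrow> 'a set topology" where
  "coset_topology G X K = quotient_topology X (\<lambda>x. x <#\<^bsub>G\<^esub> K)"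

end

theory Submission
  imports Defs
begin

text \<open>
  Right translations, left translations and inversion are all continuous for \<open>\<sigma>\<close>. In any such group a
  point \<open>x\<close> lying in every closed neighbourhood of the identity satisfies \<open>x \<otimes> A \<subseteq> closure A\<close> for every
  open \<open>A\<close>, so these points form a closed normal subgroup \<open>N\<close> with Hausdorff quotient.

  The quotient \<open>P\<close> of \<open>L\<close> by \<open>N\<close> is locally compact: it is compact if \<open>\<tau>\<close> is, and otherwise admissibility
  makes \<open>(x, y) \<mapsto> inv x \<otimes> y\<close> open. So the Baire category theorem applies to \<open>P\<close>. It gives a \<open>\<tau>\<close>-compact
  \<open>K \<subseteq> L\<close> whose image has interior, whence the two quotient topologies agree. Coset maps are open, so
  division on \<open>P\<close> is jointly continuous. For the action on \<open>G/N\<close>, Baire gives joint local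
  boundedness, and the graph, an image of the closed set of pairs with \<open>inv x \<otimes> z \<in> L\<close>, is closed.
\<close>

subsection \<open>Coset spaces of right topological groups\<close>

lemma (in group) lcos_eq_iff:
  assumes "subgroup K G" "x \<in> carrier G" "y \<in> carrier G"
  shows "x <# K = y <# K \<longleftrightarrow> inv x \<otimes> y \<in> K"
proof
  assume "x <# K = y <# K"
  then have "y \<in> x <# K"
    using assms lcos_self by auto
  then show "inv x \<otimes> y \<in> K"
    using assms subgroup.lcos_module_imp[OF assms(1) group_axioms] by blast
next
  assume "inv x \<otimes> y \<in> K"
  then have "y \<in> x <# K"
    using assms subgroup.lcos_module_rev[OF assms(1) group_axioms] by blast
  then show "x <# K = y <# K"
    using l_repr_independence assms by blast
qed

lemma continuous_map_quotient_topology: "continuous_map X (quotient_topology X f) f"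
  by (simp add: quotient_map_quotient_topology quotient_imp_continuous_map)

lemma continuous_map_between_subtopologies:
  assumes "continuous_map X Y f" "f ` H \<subseteq> K"
  shows "continuous_map (subtopology X H) (subtopology Y K) f"
  using assms by (intro continuous_map_into_subtopology continuous_map_from_subtopology) auto

text \<open>A product of quotient maps can fail to be a quotient map, but openness survives
  products, as rectangles show.\<close>

lemma open_map_prod_topology:
  assumes "open_map X X' f" "open_map Y Y' g"
  shows "open_map (prod_topology X Y) (prod_topology X' Y') (\<lambda>(x, y). (f x, g y))"
  unfolding open_map_def
proof (intro allI impI)
  fix W assume W: "openin (prod_topology X Y) W"
  show "openin (prod_topology X' Y') ((\<lambda>(x, y). (f x, g y)) ` W)"
    unfolding openin_prod_topology_alt
  proof (intro allI impI)
    fix a b assume "(a, b) \<in> (\<lambda>(x, y). (f x, g y)) ` W"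
    then obtain x y where xy: "(x, y) \<in> W" "a = f x" "b = g y" by auto
    then obtain U V where UV: "openin X U" "openin Y V" "x \<in> U" "y \<in> V" "U \<times> V \<subseteq> W"
      using W unfolding openin_prod_topology_alt by meson
    show "\<exists>U V. openin X' U \<and> openin Y' V \<and> a \<in> U \<and> b \<in> V \<and> U \<times> V \<subseteq> (\<lambda>(x, y). (f x, g y)) ` W"
    proof (intro exI conjI)
      show "openin X' (f ` U)" "openin Y' (g ` V)"
        using assms UV by (auto simp: open_map_def)
      show "f ` U \<times> g ` V \<subseteq> (\<lambda>(x, y). (f x, g y)) ` W"
        using UV(5) by force
    qed (use UV xy in auto)
  qed
qed

context right_topological_group
begin

lemma continuous_map_coset: "continuous_map T (coset_topology G T K) (\<lambda>x. x <# K)"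
  by (simp add: coset_topology_def continuous_map_quotient_topology)

lemma topspace_coset: "topspace (coset_topology G T K) = (\<lambda>x. x <# K) ` carrier G"
  by (simp add: coset_topology_def topspace_quotient_topology topspace_eq)

text \<open>The saturation of \<open>U\<close> is the union of its preimages under right
  translations by elements of \<open>K\<close>, and each of these is open.\<close>

lemma open_map_coset:
  assumes K: "subgroup K G"
  shows "open_map T (coset_topology G T K) (\<lambda>x. x <# K)"
  unfolding open_map_def
proof (intro allI impI)
  fix U assume U: "openin T U"
  then have UG: "U \<subseteq> carrier G"
    using openin_subset topspace_eq by blast
  have KG: "K \<subseteq> carrier G"
    using K by (rule subgroup.subset)
  have "{x \<in> topspace T. x <# K \<in> (\<lambda>x. x <# K) ` U} = (\<Union>k\<in>K. {x \<in> topspace T. x \<otimes> k \<in> U})"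
  proof (intro equalityI subsetI)
    fix x assume "x \<in> {x \<in> topspace T. x <# K \<in> (\<lambda>x. x <# K) ` U}"
    then obtain u where x: "x \<in> carrier G" "u \<in> U" "x <# K = u <# K"
      by (auto simp: topspace_eq)
    then have "inv x \<otimes> u \<in> K" "x \<otimes> (inv x \<otimes> u) = u"
      using UG K lcos_eq_iff by (auto simp: inv_solve_left' m_assoc[symmetric] subset_iff)
    with x show "x \<in> (\<Union>k\<in>K. {x \<in> topspace T. x \<otimes> k \<in> U})"
      by (intro UN_I[of "inv x \<otimes> u"]) (auto simp: topspace_eq)
  next
    fix x assume "x \<in> (\<Union>k\<in>K. {x \<in> topspace T. x \<otimes> k \<in> U})"
    then obtain k where k: "k \<in> K" "x \<in> carrier G" "x \<otimes> k \<in> U"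
      by (auto simp: topspace_eq)
    moreover have "x <# K = (x \<otimes> k) <# K"
      using k KG K by (subst lcos_eq_iff) (auto simp: m_assoc[symmetric] subset_iff)
    ultimately show "x \<in> {x \<in> topspace T. x <# K \<in> (\<lambda>x. x <# K) ` U}"
      by (auto simp: topspace_eq)
  qed
  moreover have "openin T {x \<in> topspace T. x \<otimes> k \<in> U}" if "k \<in> K" for k
    using that KG U by (intro openin_continuous_map_preimage[OF continuous_right_mult]) auto
  ultimately show "openin (coset_topology G T K) ((\<lambda>x. x <# K) ` U)"
    using UG by (auto simp: coset_topology_def openin_quotient_topology topspace_eq)
qed

text \<open>Openness of the coset map turns \<open>U\<close> and \<open>V\<close> into open sets of
  cosets, and the last condition in \<open>sep\<close> makes them disjoint.\<close>

lemma Hausdorff_space_coset: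
  assumes K: "subgroup K G"
    and sep: "\<And>x y. \<lbrakk>x \<in> carrier G; y \<in> carrier G; inv x \<otimes> y \<notin> K\<rbrakk> \<Longrightarrow>
      \<exists>U V. openin T U \<and> openin T V \<and> x \<in> U \<and> y \<in> V \<and> (\<forall>u\<in>U. \<forall>v\<in>V. inv u \<otimes> v \<notin> K)"
  shows "Hausdorff_space (coset_topology G T K)"
  unfolding Hausdorff_space_def
proof (intro allI impI)
  fix p r assume pr: "p \<in> topspace (coset_topology G T K) \<and> r \<in> topspace (coset_topology G T K) \<and> p \<noteq> r"
  then obtain x y where xy: "x \<in> carrier G" "y \<in> carrier G" "p = x <# K" "r = y <# K"
    by (auto simp: topspace_coset)
  with pr have "inv x \<otimes> y \<notin> K"
    using lcos_eq_iff[OF K] by simp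
  from sep[OF xy(1,2) this] obtain U V where UV: "openin T U" "openin T V" "x \<in> U" "y \<in> V"
      "\<forall>u\<in>U. \<forall>v\<in>V. inv u \<otimes> v \<notin> K"
    by (elim exE conjE)
  then have "U \<subseteq> carrier G" "V \<subseteq> carrier G"
    using openin_subset topspace_eq by blast+
  with UV(5) have "disjnt ((\<lambda>x. x <# K) ` U) ((\<lambda>x. x <# K) ` V)"
    using lcos_eq_iff[OF K] unfolding disjnt_iff by (smt (verit) image_iff subsetD)
  moreover have "openin (coset_topology G T K) ((\<lambda>x. x <# K) ` U)"
      "openin (coset_topology G T K) ((\<lambda>x. x <# K) ` V)"
    using UV open_map_coset[OF K] by (simp_all add: open_map_def)
  ultimately show "\<exists>U V. openin (coset_topology G T K) U \<and> openin (coset_topology G T K) V \<and>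
      p \<in> U \<and> r \<in> V \<and> disjnt U V"
    using UV(3,4) xy by blast
qed

lemma subgroup_right_topological_group:
  assumes "subgroup H G"
  shows "right_topological_group (G\<lparr>carrier := H\<rparr>) (subtopology T H)"
proof -
  have HG: "H \<subseteq> carrier G"
    using assms by (rule subgroup.subset)
  interpret H: group "G\<lparr>carrier := H\<rparr>"
    using assms by (rule subgroup_imp_group)
  show ?thesis
  proof
    show "topspace (subtopology T H) = carrier (G\<lparr>carrier := H\<rparr>)"
      using HG by (auto simp: topspace_eq)
    show "continuous_map (subtopology T H) (subtopology T H) (\<lambda>g. g \<otimes>\<^bsub>G\<lparr>carrier := H\<rparr>\<^esub> x)"
      if "x \<in> carrier (G\<lparr>carrier := H\<rparr>)" for x
      using that HG assms
      by (auto intro!: continuous_map_between_subtopologies continuous_right_mult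
          simp: subgroup.m_closed)
  qed
qed

text \<open>Since the coset map is open, its square is a quotient map, so continuity of division
  on the quotient can be tested on representatives.\<close>
lemma topological_group_coset:
  assumes N: "N \<lhd> G"
    and cont: "continuous_map (prod_topology T T) (coset_topology G T N) (\<lambda>(x, y). (inv x \<otimes> y) <# N)"
  shows "topological_group (G LMod N) (coset_topology G T N)"
proof -
  interpret N: normal N G by fact
  let ?P = "coset_topology G T N" and ?q = "\<lambda>x. x <# N"
  \<comment> \<open>Left and right cosets of a normal subgroup coincide, so the group laws come from
    \<open>G Mod N\<close>.\<close>
  have eq: "G LMod N = G Mod N"
    using N.coset_eq unfolding LFactGroup_def FactGroup_def LCOSETS_def RCOSETS_def by auto
  interpret Q: group "G LMod N"
    unfolding eq by (rule N.factorgroup_is_group)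
  have q_car: "?q x \<in> carrier (G LMod N)" if "x \<in> carrier G" for x
    using that by (auto simp: LFactGroup_def LCOSETS_def)
  have q_mult: "?q x \<otimes>\<^bsub>G LMod N\<^esub> ?q y = ?q (x \<otimes> y)" if "x \<in> carrier G" "y \<in> carrier G" for x y
    using that N.rcos_sum N.coset_eq by (auto simp: LFactGroup_def)
  have q_one: "?q \<one> = \<one>\<^bsub>G LMod N\<^esub>"
    using N.subset by (simp add: LFactGroup_def lcos_mult_one)
  have q_inv: "inv\<^bsub>G LMod N\<^esub> (?q x) = ?q (inv x)" if "x \<in> carrier G" for x
    using that q_one q_mult q_car by (intro Q.inv_equality) auto
  have top: "topspace ?P = carrier (G LMod N)"
    unfolding topspace_coset by (auto simp: LFactGroup_def LCOSETS_def)
  let ?qq = "\<lambda>(x, y). (?q x, ?q y)" and ?d = "\<lambda>(X, Y). inv\<^bsub>G LMod N\<^esub> X \<otimes>\<^bsub>G LMod N\<^esub> Y"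
  have qq: "quotient_map (prod_topology T T) (prod_topology ?P ?P) ?qq"
  proof (rule continuous_open_imp_quotient_map)
    show "continuous_map (prod_topology T T) (prod_topology ?P ?P) ?qq"
      using continuous_map_coset by (auto simp: continuous_map_prod_top)
    show "open_map (prod_topology T T) (prod_topology ?P ?P) ?qq"
      by (intro open_map_prod_topology open_map_coset N.subgroup_axioms)
    show "?qq ` topspace (prod_topology T T) = topspace (prod_topology ?P ?P)"
      by (auto simp: topspace_coset topspace_eq)
  qed
  have d: "continuous_map (prod_topology ?P ?P) ?P ?d"
  proof (rule continuous_compose_quotient_map[OF qq], rule continuous_map_eq[OF cont])
    show "(case z of (x, y) \<Rightarrow> (inv x \<otimes> y) <# N) = (?d \<circ> ?qq) z"
      if "z \<in> topspace (prod_topology T T)" for z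
      using that by (auto simp: topspace_eq q_mult q_inv)
  qed
  have one: "\<one>\<^bsub>G LMod N\<^esub> \<in> topspace ?P"
    by (simp add: top)
  \<comment> \<open>Both operations are recovered from division: the inverse of \<open>X\<close> is
    \<open>?d\<close> at \<open>X\<close> and the identity, and the product of \<open>X\<close> and
    \<open>Y\<close> is \<open>?d\<close> at the inverse of \<open>X\<close> and
    \<open>Y\<close>.\<close>
  have i: "continuous_map ?P ?P (\<lambda>X. inv\<^bsub>G LMod N\<^esub> X)"
  proof (rule continuous_map_eq)
    show "continuous_map ?P ?P (?d \<circ> (\<lambda>X. (X, \<one>\<^bsub>G LMod N\<^esub>)))"
      by (rule continuous_map_compose[OF _ d]) (use one in \<open>auto intro!: continuous_map_pairedI\<close>)
  qed (auto simp: top)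
  have m: "continuous_map (prod_topology ?P ?P) ?P (\<lambda>(X, Y). X \<otimes>\<^bsub>G LMod N\<^esub> Y)"
  proof (rule continuous_map_eq)
    show "continuous_map (prod_topology ?P ?P) ?P (?d \<circ> (\<lambda>(X, Y). (inv\<^bsub>G LMod N\<^esub> X, Y)))"
      by (rule continuous_map_compose[OF _ d]) (use i in \<open>auto simp: continuous_map_prod_top\<close>)
  qed (auto simp: top)
  show ?thesis
    by unfold_locales (use top i m in auto)
qed

end

subsection \<open>Quasitopological groups\<close>

locale quasitopological_group = right_topological_group +
  assumes continuous_left_mult: "x \<in> carrier G \<Longrightarrow> continuous_map T T (\<lambda>g. x \<otimes> g)"
    and continuous_inverse: "continuous_map T T (\<lambda>g. inv g)"
begin

lemma subgroup_quasitopological_group: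
  assumes "subgroup H G"
  shows "quasitopological_group (G\<lparr>carrier := H\<rparr>) (subtopology T H)"
proof -
  have HG: "H \<subseteq> carrier G"
    using assms by (rule subgroup.subset)
  interpret H: right_topological_group "G\<lparr>carrier := H\<rparr>" "subtopology T H"
    using assms by (rule subgroup_right_topological_group)
  show ?thesis
  proof
    show "continuous_map (subtopology T H) (subtopology T H) (\<lambda>g. x \<otimes>\<^bsub>G\<lparr>carrier := H\<rparr>\<^esub> g)"
      if "x \<in> carrier (G\<lparr>carrier := H\<rparr>)" for x
      using that HG assms
      by (auto intro!: continuous_map_between_subtopologies continuous_left_mult
          simp: subgroup.m_closed)
    have "continuous_map (subtopology T H) (subtopology T H) (\<lambda>g. inv g)"
      using HG assms
      by (auto intro!: continuous_map_between_subtopologies continuous_inverse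
          simp: subgroup.m_inv_closed)
    then show "continuous_map (subtopology T H) (subtopology T H) (\<lambda>g. inv\<^bsub>G\<lparr>carrier := H\<rparr>\<^esub> g)"
      by (rule continuous_map_eq) (use assms in auto)
  qed
qed

text \<open>For \<open>L\<close> with the topology induced by \<sigma>, this is N(L).\<close>

definition core :: "'a set"
  where "core = \<Inter>{C. closedin T C \<and> \<one> \<in> T interior_of C}"

lemma closedin_core: "closedin T core"
proof -
  \<comment> \<open>The whole space is one of the sets intersected, so the family is
    nonempty.\<close>
  have "\<one> \<in> T interior_of topspace T"
    using openin_topspace[of T] by (simp add: interior_of_openin topspace_eq)
  then show ?thesis
    unfolding core_def by (intro closedin_Inter) auto
qed

lemma core_subset: "core \<subseteq> carrier G"
  using closedin_core closedin_subset topspace_eq by blast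

text \<open>Closures of open neighbourhoods of \<open>\<one>\<close> are closed neighbourhoods, and
  every closed neighbourhood contains the closure of its interior.\<close>

lemma in_core_iff: "x \<in> core \<longleftrightarrow> (\<forall>U. openin T U \<and> \<one> \<in> U \<longrightarrow> x \<in> T closure_of U)"
proof
  assume x: "x \<in> core"
  show "\<forall>U. openin T U \<and> \<one> \<in> U \<longrightarrow> x \<in> T closure_of U"
  proof (intro allI impI)
    fix U assume U: "openin T U \<and> \<one> \<in> U"
    then have "U \<subseteq> T interior_of (T closure_of U)"
      by (simp add: closure_of_subset interior_of_maximal openin_subset)
    then show "x \<in> T closure_of U"
      using x U by (auto simp: core_def)
  qed
next
  assume *: "\<forall>U. openin T U \<and> \<one> \<in> U \<longrightarrow> x \<in> T closure_of U"
  show "x \<in> core"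
    unfolding core_def
  proof clarify
    fix C assume "closedin T C" "\<one> \<in> T interior_of C"
    moreover have "T closure_of (T interior_of C) \<subseteq> C"
      using \<open>closedin T C\<close> by (simp add: closure_of_minimal interior_of_subset)
    ultimately show "x \<in> C"
      using * openin_interior_of[of T C] by blast
  qed
qed

text \<open>Preimages under \<open>f\<close> of open neighbourhoods of \<open>\<one>\<close> are
  again such, and continuity carries closures into closures. This serves for inversion and
  conjugation.\<close>

lemma core_image:
  assumes f: "continuous_map T T f" and "f \<one> = \<one>" and x: "x \<in> core"
  shows "f x \<in> core"
  unfolding in_core_iff
proof (intro allI impI)
  fix U assume U: "openin T U \<and> \<one> \<in> U"
  let ?V = "{y \<in> topspace T. f y \<in> U}"
  have "openin T ?V" "\<one> \<in> ?V"
    using U assms openin_continuous_map_preimage[OF f] by (auto simp: topspace_eq)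
  then have "x \<in> T closure_of ?V"
    using x in_core_iff by blast
  then have "f x \<in> T closure_of (f ` ?V)"
    using continuous_map_image_closure_subset[OF f] by blast
  moreover have "T closure_of (f ` ?V) \<subseteq> T closure_of U"
    by (intro closure_of_mono) auto
  ultimately show "f x \<in> T closure_of U"
    by blast
qed

text \<open>For \<open>a\<close> in \<open>A\<close>, the elements \<open>y\<close> with
  \<open>y \<otimes> a\<close> in \<open>A\<close> form a neighbourhood of \<open>\<one>\<close>, so
  \<open>x\<close> is in its closure and \<open>x \<otimes> a\<close> is in that of
  \<open>A\<close>. Continuity of left translation by \<open>x\<close> then extends this from
  \<open>A\<close> to its closure.\<close>

lemma core_mult_closure:
  assumes x: "x \<in> core" and A: "openin T A" and c: "c \<in> T closure_of A"
  shows "x \<otimes> c \<in> T closure_of A"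
proof -
  have xG: "x \<in> carrier G"
    using x core_subset by blast
  have "x \<otimes> a \<in> T closure_of A" if a: "a \<in> A" for a
  proof -
    have aG: "a \<in> carrier G"
      using a A openin_subset topspace_eq by blast
    let ?V = "{y \<in> topspace T. y \<otimes> a \<in> A}"
    have "openin T ?V" "\<one> \<in> ?V"
      using A a aG openin_continuous_map_preimage[OF continuous_right_mult] by (auto simp: topspace_eq)
    then have "x \<in> T closure_of ?V"
      using x in_core_iff by blast
    then have "x \<otimes> a \<in> T closure_of ((\<lambda>y. y \<otimes> a) ` ?V)"
      using continuous_map_image_closure_subset[OF continuous_right_mult[OF aG]] by blast
    moreover have "T closure_of ((\<lambda>y. y \<otimes> a) ` ?V) \<subseteq> T closure_of A"
      by (intro closure_of_mono) auto
    ultimately show ?thesis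
      by blast
  qed
  then have "T closure_of ((\<lambda>y. x \<otimes> y) ` A) \<subseteq> T closure_of A"
    by (intro closure_of_minimal) auto
  then show ?thesis
    using continuous_map_image_closure_subset[OF continuous_left_mult[OF xG]] c by blast
qed

text \<open>Products are handled by \<open>core_mult_closure\<close>, applied to the open
  neighbourhoods of \<open>\<one>\<close>. Inversion and conjugations are continuous and fix
  \<open>\<one>\<close>.\<close>

lemma normal_core: "core \<lhd> G"
proof (rule normal_invI)
  show "subgroup core G"
  proof (rule subgroupI)
    have "\<one> \<in> core"
      unfolding in_core_iff by (meson closure_of_subset openin_subset subsetD)
    then show "core \<noteq> {}" by blast
    show "inv x \<in> core" if "x \<in> core" for x
      using core_image[OF continuous_inverse _ that] by simp
    show "x \<otimes> y \<in> core" if "x \<in> core" "y \<in> core" for x y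
      using that core_mult_closure[of x] in_core_iff[of y] in_core_iff[of "x \<otimes> y"] by blast
  qed (rule core_subset)
  show "x \<otimes> h \<otimes> inv x \<in> core" if "x \<in> carrier G" "h \<in> core" for x h
  proof (rule core_image[OF _ _ that(2)])
    show "continuous_map T T (\<lambda>h. x \<otimes> h \<otimes> inv x)"
      using continuous_map_compose[OF continuous_left_mult[of x] continuous_right_mult[of "inv x"]] that
      by (simp add: o_def)
  qed (use that in simp)
qed

text \<open>Left translation produces an open \<open>?A\<close> around \<open>x\<close> whose
  closure misses \<open>y\<close>. That closure is invariant under left multiplication by the core,
  so no coset meets both \<open>?A\<close> and the complement of the closure.\<close>

lemma Hausdorff_space_coset_core: "Hausdorff_space (coset_topology G T core)"
proof (rule Hausdorff_space_coset)
  interpret N: normal core G by (rule normal_core)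
  show "subgroup core G"
    by (rule N.subgroup_axioms)
  fix x y assume xy: "x \<in> carrier G" "y \<in> carrier G" "inv x \<otimes> y \<notin> core"
  then obtain U where U: "openin T U" "\<one> \<in> U" "inv x \<otimes> y \<notin> T closure_of U"
    using in_core_iff by blast
  let ?A = "{z \<in> topspace T. inv x \<otimes> z \<in> U}"
  have A: "openin T ?A" "x \<in> ?A"
    using U xy openin_continuous_map_preimage[OF continuous_left_mult] by (auto simp: topspace_eq)
  have "y \<notin> T closure_of ?A"
  proof
    assume "y \<in> T closure_of ?A"
    then have "inv x \<otimes> y \<in> T closure_of ((\<lambda>z. inv x \<otimes> z) ` ?A)"
      using continuous_map_image_closure_subset[OF continuous_left_mult[of "inv x"]] xy by blast
    moreover have "T closure_of ((\<lambda>z. inv x \<otimes> z) ` ?A) \<subseteq> T closure_of U"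
      by (intro closure_of_mono) auto
    ultimately show False
      using U(3) by blast
  qed
  moreover have "inv u \<otimes> v \<notin> core" if uv: "u \<in> ?A" "v \<in> topspace T - T closure_of ?A" for u v
  proof
    assume *: "inv u \<otimes> v \<in> core"
    have G: "u \<in> carrier G" "v \<in> carrier G"
      using uv by (auto simp: topspace_eq)
    \<comment> \<open>Conjugating by \<open>u\<close> writes \<open>v\<close> as a core element
      times \<open>u\<close>, the form to which \<open>core_mult_closure\<close> applies.\<close>
    then have "u \<otimes> (inv u \<otimes> v) \<otimes> inv u \<in> core"
      using * N.inv_op_closed2 by blast
    then have "v \<otimes> inv u \<in> core"
      using G by (simp add: m_assoc[symmetric])
    moreover have "u \<in> T closure_of ?A"
      using uv closure_of_subset[of ?A T] by blast
    ultimately have "v \<otimes> inv u \<otimes> u \<in> T closure_of ?A"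
      using A core_mult_closure by blast
    then show False
      using uv G by (simp add: m_assoc)
  qed
  moreover have "openin T (topspace T - T closure_of ?A)"
    by (simp add: openin_diff)
  ultimately show "\<exists>U V. openin T U \<and> openin T V \<and> x \<in> U \<and> y \<in> V \<and> (\<forall>u\<in>U. \<forall>v\<in>V. inv u \<otimes> v \<notin> core)"
    using A xy(2) topspace_eq by blast
qed

end

subsection \<open>The \<open>\<sigma>\<close>-topology\<close>

context right_topological_group
begin

abbreviation \<sigma> :: "'a topology"
  where "\<sigma> \<equiv> sigma_topology G T"

lemma quotient_map_division: "quotient_map (prod_topology T T) \<sigma> (\<lambda>(x, y). inv x \<otimes> y)"
  by (simp add: sigma_topology_def quotient_map_quotient_topology)

lemma continuous_map_division: "continuous_map (prod_topology T T) \<sigma> (\<lambda>(x, y). inv x \<otimes> y)"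
  by (rule quotient_imp_continuous_map[OF quotient_map_division])

lemma topspace_sigma: "topspace \<sigma> = carrier G"
proof -
  have "x \<in> (\<lambda>(x, y). inv x \<otimes> y) ` (carrier G \<times> carrier G)" if "x \<in> carrier G" for x
    using that by (intro image_eqI[of _ _ "(\<one>, x)"]) auto
  then show ?thesis
    unfolding sigma_topology_def topspace_quotient_topology by (auto simp: topspace_eq)
qed

text \<open>Division with first entry \<open>\<one>\<close> is the identity map; hence \<sigma> is
  coarser than \<open>T\<close>.\<close>

lemma continuous_map_sigma_id: "continuous_map T \<sigma> (\<lambda>x. x)"
proof (rule continuous_map_eq)
  show "continuous_map T \<sigma> ((\<lambda>(x, y). inv x \<otimes> y) \<circ> (\<lambda>y. (\<one>, y)))"
    by (rule continuous_map_compose[OF _ continuous_map_division])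
       (auto intro!: continuous_map_pairedI simp: topspace_eq)
qed (auto simp: topspace_eq)

text \<open>By the quotient property, a self-map of \<open>G\<close> is \<sigma>-continuous once it
  lifts through division to a continuous map of pairs. The lifts needed here involve only right
  translations and the swap.\<close>

lemma quasitopological_group_sigma: "quasitopological_group G \<sigma>"
proof -
  have lift: "continuous_map \<sigma> \<sigma> f"
    if h: "continuous_map (prod_topology T T) (prod_topology T T) h"
      and eq: "\<And>x y. \<lbrakk>x \<in> carrier G; y \<in> carrier G\<rbrakk> \<Longrightarrow>
         (\<lambda>(x, y). inv x \<otimes> y) (h (x, y)) = f (inv x \<otimes> y)" for f h
  proof (rule continuous_compose_quotient_map[OF quotient_map_division])
    show "continuous_map (prod_topology T T) \<sigma> (f \<circ> (\<lambda>(x, y). inv x \<otimes> y))"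
      by (rule continuous_map_eq[OF continuous_map_compose[OF h continuous_map_division]])
         (use eq in \<open>auto simp: topspace_eq\<close>)
  qed
  show ?thesis
  proof
    show "topspace \<sigma> = carrier G"
      by (rule topspace_sigma)
    fix g assume g: "g \<in> carrier G"
    show "continuous_map \<sigma> \<sigma> (\<lambda>x. x \<otimes> g)"
    proof (rule lift)
      show "continuous_map (prod_topology T T) (prod_topology T T) (\<lambda>(x, y). (x, y \<otimes> g))"
        using continuous_right_mult[OF g] by (auto simp: continuous_map_prod_top)
    qed (use g in \<open>auto simp: m_assoc\<close>)
    show "continuous_map \<sigma> \<sigma> (\<lambda>x. g \<otimes> x)"
    proof (rule lift)
      show "continuous_map (prod_topology T T) (prod_topology T T) (\<lambda>(x, y). (x \<otimes> inv g, y))"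
        using continuous_right_mult[of "inv g"] g by (auto simp: continuous_map_prod_top)
    qed (use g in \<open>auto simp: m_assoc inv_mult_group\<close>)
  next
    show "continuous_map \<sigma> \<sigma> (\<lambda>x. inv x)"
    proof (rule lift)
      show "continuous_map (prod_topology T T) (prod_topology T T) (\<lambda>(x, y). (y, x))"
        unfolding case_prod_beta by (intro continuous_map_pairedI continuous_map_fst continuous_map_snd)
    qed (auto simp: inv_mult_group)
  qed
qed

text \<open>Two pairs with the same quotient differ by a common left factor, and left translation by
  it may be discontinuous. By density the factor can be moved into the topological center without
  leaving a given rectangle.\<close>

lemma open_map_division:
  assumes "admissible G T"
  shows "open_map (prod_topology T T) \<sigma> (\<lambda>(x, y). inv x \<otimes> y)"
  unfolding open_map_def
proof (intro allI impI)
  let ?d = "\<lambda>(x, y). inv x \<otimes> y"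
  fix W assume W: "openin (prod_topology T T) W"
  have WG: "W \<subseteq> carrier G \<times> carrier G"
    using openin_subset[OF W] by (simp add: topspace_eq)
  have "openin (prod_topology T T) {z \<in> topspace (prod_topology T T). ?d z \<in> ?d ` W}"
    unfolding openin_prod_topology_alt
  proof (intro allI impI)
    fix a b assume "(a, b) \<in> {z \<in> topspace (prod_topology T T). ?d z \<in> ?d ` W}"
    then obtain x y where xy: "(x, y) \<in> W" "inv a \<otimes> b = inv x \<otimes> y" and ab: "a \<in> carrier G" "b \<in> carrier G"
      by (auto simp: topspace_eq)
    then have xyG: "x \<in> carrier G" "y \<in> carrier G"
      using WG by auto
    obtain U V where UV: "openin T U" "openin T V" "x \<in> U" "y \<in> V" "U \<times> V \<subseteq> W"
      using W xy(1) unfolding openin_prod_topology_alt by meson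
    let ?w = "x \<otimes> inv a"
    \<comment> \<open>The factor \<open>?w\<close> carries \<open>(a, b)\<close> to
      \<open>(x, y)\<close>. Carrying \<open>(a, b)\<close> into \<open>U \<times> V\<close> is an
      open condition on the factor, since \<open>a\<close> and \<open>b\<close> act on it by right
      translation.\<close>
    define O' where "O' = {w \<in> topspace T. w \<otimes> a \<in> U} \<inter> {w \<in> topspace T. w \<otimes> b \<in> V}"
    have "openin T O'"
      unfolding O'_def using UV ab by (intro openin_Int openin_continuous_map_preimage[OF continuous_right_mult])
    moreover have "?w \<otimes> b = y"
      using ab xyG xy(2) by (simp add: m_assoc) (simp add: m_assoc[symmetric])
    then have "?w \<in> O'"
      unfolding O'_def using UV ab xyG by (auto simp: topspace_eq m_assoc)
    moreover have "?w \<in> T closure_of (topological_center G T)"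
      using assms ab xyG by (simp add: admissible_def topspace_eq)
    ultimately obtain w where w: "w \<in> topological_center G T" "w \<in> O'"
      unfolding in_closure_of by (metis (no_types, lifting))
    then have wG: "w \<in> carrier G" and wc: "continuous_map T T (\<lambda>g. w \<otimes> g)"
      by (auto simp: topological_center_def)
    let ?U = "{g \<in> topspace T. w \<otimes> g \<in> U}" and ?V = "{g \<in> topspace T. w \<otimes> g \<in> V}"
    \<comment> \<open>Division does not change when both entries are multiplied on the left by
      \<open>w\<close>.\<close>
    have "?U \<times> ?V \<subseteq> {z \<in> topspace (prod_topology T T). ?d z \<in> ?d ` W}"
    proof clarify
      fix g h assume gh: "g \<in> topspace T" "w \<otimes> g \<in> U" "h \<in> topspace T" "w \<otimes> h \<in> V"
      then have "inv (w \<otimes> g) \<otimes> (w \<otimes> h) = inv g \<otimes> h"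
        using wG by (simp add: topspace_eq inv_mult_group m_assoc) (simp add: m_assoc[symmetric])
      moreover have "(w \<otimes> g, w \<otimes> h) \<in> W"
        using gh UV by blast
      ultimately show "(g, h) \<in> topspace (prod_topology T T) \<and> inv g \<otimes> h \<in> ?d ` W"
        using gh by force
    qed
    moreover have "openin T ?U" "openin T ?V"
      using UV openin_continuous_map_preimage[OF wc] by auto
    moreover have "a \<in> ?U" "b \<in> ?V"
      using w(2) ab unfolding O'_def by (auto simp: topspace_eq)
    ultimately show "\<exists>U V. openin T U \<and> openin T V \<and> a \<in> U \<and> b \<in> V \<and>
        U \<times> V \<subseteq> {z \<in> topspace (prod_topology T T). ?d z \<in> ?d ` W}"
      by blast
  qed
  then show "openin \<sigma> (?d ` W)"
    using openin_subset[OF W] unfolding sigma_topology_def openin_quotient_topology by blast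
qed

end

subsection \<open>Quotients of \<open>\<sigma>\<close>-closed subgroups\<close>

text \<open>Each compact piece is enlarged to a compact neighbourhood. The finite unions of these
  are countable in number, and a compact set is covered by finitely many of the open sets inside
  them.\<close>

lemma sigma_compact_exhaustion:
  assumes "Hausdorff_space X" "locally_compact_space X" "sigma_compact_space X"
  shows "\<exists>\<C>. countable \<C> \<and> (\<forall>C\<in>\<C>. compactin X C) \<and> (\<forall>A. compactin X A \<longrightarrow> (\<exists>C\<in>\<C>. A \<subseteq> C))"
proof -
  obtain \<K> where \<K>: "countable \<K>" "\<forall>K\<in>\<K>. compactin X K" "\<Union>\<K> = topspace X"
    using assms(3) unfolding sigma_compact_space_def by (elim exE conjE)
  have "\<forall>K\<in>\<K>. \<exists>VC. openin X (fst VC) \<and> compactin X (snd VC) \<and> K \<subseteq> fst VC \<and> fst VC \<subseteq> snd VC"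
    using assms(1,2) \<K>(2) locally_compact_space_compact_closed_compact[of X]
    by (metis fst_conv snd_conv)
  then obtain p where p: "\<forall>K\<in>\<K>. openin X (fst (p K)) \<and> compactin X (snd (p K)) \<and>
      K \<subseteq> fst (p K) \<and> fst (p K) \<subseteq> snd (p K)"
    by (rule bchoice[THEN exE])
  define V where "V K = fst (p K)" for K
  define c where "c K = snd (p K)" for K
  have V: "openin X (V K)" "K \<subseteq> V K" "V K \<subseteq> c K" and c: "compactin X (c K)" if "K \<in> \<K>" for K
    using p that by (auto simp: V_def c_def)
  show ?thesis
  proof (intro exI conjI ballI allI impI)
    show "countable (Union ` {\<F>. finite \<F> \<and> \<F> \<subseteq> c ` \<K>})"
      using \<K>(1) by (intro countable_image countable_Collect_finite_subset)
    show "compactin X D" if "D \<in> Union ` {\<F>. finite \<F> \<and> \<F> \<subseteq> c ` \<K>}" for D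
      using that c by (auto intro!: compactin_Union)
    show "\<exists>D\<in>Union ` {\<F>. finite \<F> \<and> \<F> \<subseteq> c ` \<K>}. A \<subseteq> D" if A: "compactin X A" for A
    proof -
      have "A \<subseteq> \<Union>\<K>"
        using A \<K>(3) compactin_subset_topspace by simp
      then have "A \<subseteq> \<Union>(V ` \<K>)"
        using V(2) by blast
      moreover have "Ball (V ` \<K>) (openin X)"
        using V(1) by simp
      ultimately obtain \<F> where \<F>: "finite \<F>" "\<F> \<subseteq> V ` \<K>" "A \<subseteq> \<Union>\<F>"
        using A unfolding compactin_def by meson
      then obtain \<K>' where \<K>': "\<K>' \<subseteq> \<K>" "finite \<K>'" "\<F> = V ` \<K>'"
        using finite_subset_image by meson
      have "\<Union>(V ` \<K>') \<subseteq> \<Union>(c ` \<K>')"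
        using \<K>'(1) V(3) by (intro UN_mono) auto
      then have "A \<subseteq> \<Union>(c ` \<K>')"
        using \<F>(3) \<K>'(3) by simp
      then show ?thesis
        using \<K>' by (intro bexI[of _ "\<Union>(c ` \<K>')"] imageI) auto
    qed
  qed
qed

text \<open>N(L) enters the rest of the argument only through the three properties assumed of
  \<open>N\<close> here, so it is kept abstract.\<close>

locale sigma_closed_subgroup_quotient = right_topological_group +
  fixes L N :: "'a set"
  assumes Hausdorff: "Hausdorff_space T"
    and compact_or_admissible: "compact_space T \<or>
      (locally_compact_space T \<and> sigma_compact_space T \<and> admissible G T)"
    and subgroup_L: "subgroup L G"
    and closedin_L: "closedin \<sigma> L"
    and normal_N: "N \<lhd> G\<lparr>carrier := L\<rparr>"
    and closedin_N: "closedin (subtopology \<sigma> L) N"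
    and Hausdorff_quotient: "Hausdorff_space (coset_topology G (subtopology \<sigma> L) N)"
begin

abbreviation P :: "'a set topology"
  where "P \<equiv> coset_topology G (subtopology \<sigma> L) N"

abbreviation q :: "'a \<Rightarrow> 'a set"
  where "q x \<equiv> x <# N"

lemma locally_compact: "locally_compact_space T"
  using compact_or_admissible compact_imp_locally_compact_space by blast

lemma sigma_compact: "sigma_compact_space T"
proof -
  have "sigma_compact_space T" if "compact_space T"
    using that unfolding sigma_compact_space_def compact_space_def
    by (intro exI[of _ "{topspace T}"]) simp
  then show ?thesis
    using compact_or_admissible by blast
qed

lemma L_subset: "L \<subseteq> carrier G"
  using subgroup_L by (rule subgroup.subset)

lemma subgroup_N: "subgroup N G"
  using incl_subgroup[OF subgroup_L] normal_N normal_def by blast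

lemma N_subset_L: "N \<subseteq> L"
  using normal_N subgroup.subset unfolding normal_def by fastforce

section \<open>Coset arithmetic modulo \<open>N\<close>\<close>

lemma conj_N: "inv g \<otimes> n \<otimes> g \<in> N" if "g \<in> L" "n \<in> N"
  using normal.inv_op_closed1[OF normal_N, of g n] that subgroup_L by simp

text \<open>Normality of \<open>N\<close> in \<open>L\<close> gives Ng = gN for \<open>g\<close> in
  \<open>L\<close>, so right translation by \<open>L\<close> acts on the left cosets of
  \<open>N\<close> in all of \<open>G\<close>.\<close>

lemma q_r_coset:
  assumes "x \<in> carrier G" "g \<in> L"
  shows "q x #> g = q (x \<otimes> g)"
proof -
  have g: "g \<in> carrier G" and NG: "\<And>n. n \<in> N \<Longrightarrow> n \<in> carrier G"
    using assms L_subset N_subset_L by auto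
  have 1: "x \<otimes> n \<otimes> g = x \<otimes> g \<otimes> (inv g \<otimes> n \<otimes> g)" if "n \<in> N" for n
    using assms g NG[OF that] by (simp add: m_assoc) (simp add: m_assoc[symmetric])
  have 2: "x \<otimes> g \<otimes> n = x \<otimes> (g \<otimes> n \<otimes> inv g) \<otimes> g" if "n \<in> N" for n
    using assms g NG[OF that] by (simp add: m_assoc)
  have 3: "g \<otimes> n \<otimes> inv g \<in> N" if "n \<in> N" for n
    using conj_N[of "inv g" n] assms that g subgroup_L by (simp add: subgroup.m_inv_closed)
  show ?thesis
    unfolding l_coset_def r_coset_def using 1 2 3 conj_N[OF assms(2)] by blast
qed

text \<open>Makes the product of subsets a representative-free form of the map sending ([x], [y]) to
  [xy].\<close>

lemma q_set_mult:
  assumes "x \<in> carrier G" "y \<in> L"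
  shows "q x <#> q y = q (x \<otimes> y)"
proof -
  have "q x <#> q y = (q x #> y) <#> N"
    using assms L_subset N_subset_L unfolding l_coset_def r_coset_def set_mult_def
    by (fastforce simp: m_assoc subset_iff)
  also have "\<dots> = q (x \<otimes> y) <#> N"
    using q_r_coset assms by simp
  also have "\<dots> = q (x \<otimes> y)"
  proof -
    have xy: "x \<otimes> y \<in> carrier G"
      using assms L_subset by auto
    have NG: "N \<subseteq> carrier G"
      using subgroup_N by (rule subgroup.subset)
    have "q (x \<otimes> y) <#> N = (x \<otimes> y) <# (N <#> N)"
      using setmult_lcos_assoc[of N N "x \<otimes> y"] xy NG by (simp add: set_mult_def l_coset_def)
    then show ?thesis
      using subgroup_mult_id[OF subgroup_N] by simp
  qed
  finally show ?thesis .
qed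

text \<open>The space \<open>X\<close> is generic to cover three cases: \<open>L\<close> with either
  topology, and \<open>G\<close> with \<open>T\<close>.\<close>

lemma continuous_map_r_coset:
  assumes "g \<in> L" "topspace X \<subseteq> carrier G" "continuous_map X X (\<lambda>x. x \<otimes> g)"
  shows "continuous_map (coset_topology G X N) (coset_topology G X N) (\<lambda>p. p #> g)"
  unfolding coset_topology_def
proof (rule continuous_compose_quotient_map[OF quotient_map_quotient_topology])
  show "continuous_map X (quotient_topology X q) ((\<lambda>p. p #> g) \<circ> q)"
    by (rule continuous_map_eq[OF continuous_map_compose[OF assms(3) continuous_map_quotient_topology]])
       (use assms q_r_coset in auto)
qed

sublocale LT: right_topological_group "G\<lparr>carrier := L\<rparr>" "subtopology T L"
  by (rule subgroup_right_topological_group[OF subgroup_L])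

sublocale LS: quasitopological_group "G\<lparr>carrier := L\<rparr>" "subtopology \<sigma> L"
  by (rule quasitopological_group.subgroup_quasitopological_group[OF quasitopological_group_sigma subgroup_L])

lemma topspace_P: "topspace P = q ` L"
  using L_subset by (auto simp: coset_topology_def topspace_quotient_topology topspace_sigma)

section \<open>Closed sets and continuous maps obtained from \<sigma>, and local compactness\<close>

lemma closedin_T_L: "closedin T L"
proof -
  have "closedin T {x \<in> topspace T. x \<in> L}"
    using closedin_L by (rule closedin_continuous_map_preimage[OF continuous_map_sigma_id])
  moreover have "{x \<in> topspace T. x \<in> L} = L"
    using L_subset by (auto simp: topspace_eq)
  ultimately show ?thesis by simp
qed

lemma continuous_map_q_P: "continuous_map (subtopology \<sigma> L) P q"
  unfolding coset_topology_def by (rule continuous_map_quotient_topology)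

lemma continuous_map_q: "continuous_map (subtopology T L) P q"
proof -
  have "continuous_map (subtopology T L) (subtopology \<sigma> L) (\<lambda>x. x)"
    by (rule continuous_map_between_subtopologies[OF continuous_map_sigma_id]) simp
  then show ?thesis
    using continuous_map_compose[OF _ continuous_map_q_P] by (simp add: o_def)
qed

text \<open>These are the pairs \<open>(x, x \<otimes> y)\<close> with \<open>y\<close> in
  \<open>L\<close>. Describing the action by such pairs replaces multiplication, which may fail to
  be jointly continuous, by division, which is continuous into \<sigma>.\<close>

definition M :: "('a \<times> 'a) set"
  where "M = {(x, z). x \<in> carrier G \<and> z \<in> carrier G \<and> inv x \<otimes> z \<in> L}"

lemma closedin_M: "closedin (prod_topology T T) M"
proof -
  have "closedin (prod_topology T T) {z \<in> topspace (prod_topology T T). (\<lambda>(x, y). inv x \<otimes> y) z \<in> L}"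
    using closedin_L by (rule closedin_continuous_map_preimage[OF continuous_map_division])
  moreover have "{z \<in> topspace (prod_topology T T). (\<lambda>(x, y). inv x \<otimes> y) z \<in> L} = M"
    by (auto simp: topspace_eq M_def)
  ultimately show ?thesis by simp
qed

lemma continuous_map_q_division:
  "continuous_map (subtopology (prod_topology T T) M) P (\<lambda>(x, z). q (inv x \<otimes> z))"
proof -
  have "continuous_map (subtopology (prod_topology T T) M) (subtopology \<sigma> L) (\<lambda>(x, y). inv x \<otimes> y)"
    by (intro continuous_map_into_subtopology continuous_map_from_subtopology continuous_map_division)
       (auto simp: M_def)
  from continuous_map_compose[OF this continuous_map_q_P] show ?thesis
    by (simp add: o_def case_prod_unfold)
qed

text \<open>If \<open>T\<close> is compact, \<open>P\<close> is a continuous image of the compact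
  set \<open>L\<close>. Otherwise division followed by the coset map is a continuous open surjection
  onto \<open>P\<close> from \<open>M\<close>, a closed subset of a locally compact space.\<close>

lemma locally_compact_quotient: "locally_compact_space P"
  using compact_or_admissible
proof (elim disjE conjE)
  assume "compact_space T"
  then have "compactin (subtopology T L) L"
    using closedin_T_L by (simp add: compactin_subtopology closedin_compact_space)
  then have "compactin P (q ` L)"
    by (rule image_compactin[OF _ continuous_map_q])
  then have "compact_space P"
    by (simp add: compact_space_def topspace_P)
  then show ?thesis
    by (rule compact_imp_locally_compact_space)
next
  assume adm: "admissible G T"
  let ?d = "\<lambda>(x, z). inv x \<otimes> z" and ?X = "subtopology (prod_topology T T) M"
  \<comment> \<open>Division stays open after restriction because \<open>M\<close> is the full
    preimage of \<open>L\<close>.\<close>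
  have "open_map ?X (subtopology \<sigma> L) ?d"
    by (rule open_map_restriction[OF open_map_division[OF adm]]) (auto simp: topspace_eq M_def)
  moreover have "open_map (subtopology \<sigma> L) P q"
    using LS.open_map_coset[of N] normal_N by (simp add: coset_topology_def normal_def)
  ultimately have "open_map ?X P (q \<circ> ?d)"
    by (rule open_map_compose)
  moreover have "q \<circ> ?d = (\<lambda>(x, z). q (inv x \<otimes> z))"
    by auto
  ultimately have om: "open_map ?X P (\<lambda>(x, z). q (inv x \<otimes> z))"
    by simp
  have surj: "(\<lambda>(x, z). q (inv x \<otimes> z)) ` topspace ?X = topspace P"
  proof (intro equalityI subsetI)
    show "p \<in> topspace P" if "p \<in> (\<lambda>(x, z). q (inv x \<otimes> z)) ` topspace ?X" for p
      using that by (auto simp: topspace_P M_def)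
    fix p assume "p \<in> topspace P"
    then obtain y where y: "y \<in> L" "p = q y"
      unfolding topspace_P by (elim imageE)
    then have "(\<one>, y) \<in> topspace ?X"
      using L_subset by (auto simp: topspace_eq M_def)
    then show "p \<in> (\<lambda>(x, z). q (inv x \<otimes> z)) ` topspace ?X"
      using y L_subset by (intro image_eqI[of _ _ "(\<one>, y)"]) auto
  qed
  have "locally_compact_space ?X"
    using closedin_M by (rule locally_compact_space_closed_subset[rotated])
      (simp add: locally_compact_space_prod_topology locally_compact)
  then show ?thesis
    by (rule locally_compact_space_continuous_open_map_image[OF continuous_map_q_division om surj])
qed

section \<open>Baire category in the quotient of \<open>L\<close> and equality of the quotient
  topologies\<close>

lemma continuous_map_r_coset_P:
  assumes "g \<in> L"
  shows "continuous_map P P (\<lambda>p. p #> g)"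
  using continuous_map_r_coset[of g "subtopology \<sigma> L"] LS.continuous_right_mult[of g] assms L_subset
  by (auto simp: topspace_sigma)

text \<open>\<open>P\<close> is nonempty, locally compact and regular, so it has no countable cover
  by closed sets with empty interior.\<close>

lemma Baire_quotient:
  assumes "countable \<G>" "\<And>C. C \<in> \<G> \<Longrightarrow> closedin P C" "\<Union>\<G> = topspace P"
  obtains C where "C \<in> \<G>" "P interior_of C \<noteq> {}"
proof -
  have "regular_space P"
    using locally_compact_quotient Hausdorff_quotient locally_compact_Hausdorff_imp_regular_space by blast
  moreover have "topspace P \<noteq> {}"
    using subgroup.one_closed[OF subgroup_L] unfolding topspace_P by blast
  then have "P interior_of \<Union>\<G> \<noteq> {}"
    unfolding assms(3) interior_of_topspace .
  ultimately have "\<exists>C\<in>\<G>. P interior_of C \<noteq> {}"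
    using Baire_category_alt[of P \<G>] locally_compact_quotient assms(1,2) by metis
  then show thesis
    by (elim bexE) (rule that)
qed

text \<open>A countable compact cover of \<open>G\<close>, intersected with the closed set
  \<open>L\<close>, has images that are compact, hence closed, in the Hausdorff space
  \<open>P\<close>, and that cover it.\<close>

lemma compact_with_interior:
  obtains K where "compactin (subtopology T L) K" "P interior_of (q ` K) \<noteq> {}"
proof -
  obtain \<K> where \<K>: "countable \<K>" "\<forall>K\<in>\<K>. compactin T K" "\<Union>\<K> = topspace T"
    using sigma_compact unfolding sigma_compact_space_def by (elim exE conjE)
  have cpt: "compactin (subtopology T L) (K \<inter> L)" if "K \<in> \<K>" for K
    using that \<K>(2) closedin_T_L by (simp add: compactin_subtopology compact_Int_closedin)
  have "\<Union>((\<lambda>K. q ` (K \<inter> L)) ` \<K>) = topspace P"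
    using \<K>(3) L_subset unfolding topspace_P topspace_eq by blast
  moreover have "closedin P (q ` (K \<inter> L))" if "K \<in> \<K>" for K
    using compactin_imp_closedin[OF Hausdorff_quotient image_compactin[OF cpt[OF that] continuous_map_q]] .
  ultimately obtain C where "C \<in> (\<lambda>K. q ` (K \<inter> L)) ` \<K>" "P interior_of C \<noteq> {}"
    using \<K>(1) by (elim Baire_quotient[rotated 2]) auto
  then show thesis
    using cpt that by blast
qed

text \<open>The two quotient topologies agree on the compact set \<open>q ` K\<close>, hence near an interior point
  of it, hence everywhere because right translations are homeomorphisms for both.\<close>
lemma coset_topology_eq: "coset_topology G (subtopology T L) N = P"
  (is "?Q = P")
  unfolding topology_eq
proof (intro allI iffI)
  have top: "topspace ?Q = q ` L"
    using L_subset by (auto simp: coset_topology_def topspace_quotient_topology topspace_eq)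
  have top_T: "topspace (subtopology T L) = L"
    using L_subset by (auto simp: topspace_eq)
  have q_Q: "continuous_map (subtopology T L) ?Q q"
    unfolding coset_topology_def by (rule continuous_map_quotient_topology)
  fix W
  \<comment> \<open>This direction only says that \<sigma> is coarser than \<open>T\<close>.\<close>
  show "openin ?Q W" if W: "openin P W"
    using openin_continuous_map_preimage[OF continuous_map_q W] openin_subset[OF W]
    unfolding coset_topology_def openin_quotient_topology top_T topspace_P[unfolded coset_topology_def]
    by (rule conjI[rotated])
  show "openin P W" if W: "openin ?Q W"
  proof (subst openin_subopen, intro ballI)
    obtain K where K: "compactin (subtopology T L) K" "P interior_of (q ` K) \<noteq> {}"
      by (rule compact_with_interior)
    let ?O = "P interior_of (q ` K)"
    fix p assume p: "p \<in> W"
    then obtain x where x: "x \<in> L" "p = q x"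
      using openin_subset[OF W] top by auto
    have "?O \<subseteq> q ` L"
      using interior_of_subset_topspace[of P "q ` K"] unfolding topspace_P .
    moreover obtain r where r: "r \<in> ?O"
      using K(2) unfolding ex_in_conv[symmetric] by (elim exE)
    ultimately have "r \<in> q ` L"
      by (rule subsetD)
    then obtain x1 where "r = q x1" "x1 \<in> L"
      by (rule imageE)
    with r have x1: "x1 \<in> L" "q x1 \<in> ?O"
      by simp_all
    \<comment> \<open>Right translation by \<open>g\<close> moves \<open>p\<close> to the interior
      point \<open>q x1\<close>, and \<open>W'\<close> below is the corresponding translate of
      \<open>W\<close>.\<close>
    define g where "g = inv x \<otimes> x1"
    have g: "g \<in> L" "inv g \<in> L"
      using x x1 subgroup_L by (auto simp: g_def subgroup.m_closed subgroup.m_inv_closed)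
    have gG: "g \<in> carrier G" "x \<in> carrier G" "x1 \<in> carrier G"
      using g x x1 L_subset by auto
    have qg: "q x #> g = q x1"
      using q_r_coset[OF gG(2) g(1)] gG by (simp add: g_def m_assoc[symmetric])
    define W' where "W' = {r \<in> topspace ?Q. r #> inv g \<in> W}"
    have W': "openin ?Q W'"
      unfolding W'_def
    proof (rule openin_continuous_map_preimage[OF continuous_map_r_coset W])
      show "continuous_map (subtopology T L) (subtopology T L) (\<lambda>x. x \<otimes> inv g)"
        using LT.continuous_right_mult[of "inv g"] g by simp
    qed (use g top_T L_subset in auto)
    have gg: "r #> g #> inv g = r" if "r \<in> q ` L" for r
      using that q_r_coset g gG L_subset subgroup_L
      by (auto simp: subgroup.m_closed m_assoc subset_iff)
    have rg: "r #> g \<in> q ` L" if "r \<in> q ` L" for r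
      using that q_r_coset g L_subset subgroup_L by (auto simp: subgroup.m_closed subset_iff)
    \<comment> \<open>The part of \<open>K\<close> outside \<open>?D\<close> is compact, so its
      image is closed in \<open>P\<close>, and \<open>?O\<close> minus that image is open. The
      difference lies in \<open>W'\<close>, since each point of \<open>?O\<close> has a
      representative in \<open>K\<close>.\<close>
    let ?D = "{x \<in> topspace (subtopology T L). q x \<in> W'}"
    have "openin (subtopology T L) ?D"
      by (rule openin_continuous_map_preimage[OF q_Q W'])
    then have "compactin (subtopology T L) (K \<inter> (topspace (subtopology T L) - ?D))"
      by (intro compact_Int_closedin[OF K(1)] closedin_diff closedin_topspace)
    moreover have "K \<inter> (topspace (subtopology T L) - ?D) = K - ?D"
      using compactin_subset_topspace[OF K(1)] by blast
    ultimately have "compactin (subtopology T L) (K - ?D)"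
      by metis
    then have "closedin P (q ` (K - ?D))"
      using image_compactin[OF _ continuous_map_q] compactin_imp_closedin[OF Hausdorff_quotient] by blast
    then have "openin P (?O - q ` (K - ?D))"
      by (intro openin_diff) auto
    then have *: "openin P {r \<in> topspace P. r #> g \<in> ?O - q ` (K - ?D)}"
      by (rule openin_continuous_map_preimage[OF continuous_map_r_coset_P[OF g(1)]])
    have KL: "K \<subseteq> L"
      using K(1) by (simp add: compactin_subtopology)
    have sub: "?O - q ` (K - ?D) \<subseteq> W'"
      using interior_of_subset[of P "q ` K"] by blast
    have "r \<in> W" if "r \<in> topspace P" "r #> g \<in> ?O - q ` (K - ?D)" for r
    proof -
      have "r #> g \<in> W'"
        using that(2) sub by blast
      then show ?thesis
        using gg that(1) unfolding W'_def topspace_P by simp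
    qed
    moreover have "q x1 \<in> W'"
      using gg[of "q x"] qg p x x1 unfolding W'_def top by auto
    then have "q x1 \<notin> q ` (K - ?D)"
      using KL unfolding top_T by auto
    then have "p \<in> {r \<in> topspace P. r #> g \<in> ?O - q ` (K - ?D)}"
      using x x1 qg by (simp add: topspace_P)
    ultimately show "\<exists>U. openin P U \<and> p \<in> U \<and> U \<subseteq> W"
      using * by blast
  qed
qed

section \<open>The quotient of \<open>L\<close> as a \<sigma>-compact topological group\<close>

lemma sigma_compact_space_P: "sigma_compact_space P"
proof -
  obtain \<K> where \<K>: "countable \<K>" "\<forall>K\<in>\<K>. compactin T K" "\<Union>\<K> = topspace T"
    using sigma_compact unfolding sigma_compact_space_def by (elim exE conjE)
  have "compactin P (q ` (K \<inter> L))" if "K \<in> \<K>" for K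
    using that \<K>(2) closedin_T_L
    by (intro image_compactin[OF _ continuous_map_q]) (simp add: compactin_subtopology compact_Int_closedin)
  moreover have "\<Union>((\<lambda>K. q ` (K \<inter> L)) ` \<K>) = topspace P"
    using \<K>(3) L_subset unfolding topspace_P topspace_eq by blast
  ultimately show ?thesis
    using \<K>(1) unfolding sigma_compact_space_def
    by (intro exI[of _ "(\<lambda>K. q ` (K \<inter> L)) ` \<K>"]) auto
qed

text \<open>Division on \<open>L \<times> L\<close> is jointly continuous from \<open>T\<close> into
  \<open>P\<close>, as a restriction of a map on \<open>M\<close>. Equality of the two quotient
  topologies then lets \<open>P\<close> be the quotient of both source and target.\<close>

lemma topological_group_P: "topological_group (G\<lparr>carrier := L\<rparr> LMod N) P"
proof -
  have "continuous_map (subtopology (prod_topology T T) (L \<times> L)) P (\<lambda>(x, z). q (inv x \<otimes> z))"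
    using subgroup_L L_subset
    by (intro continuous_map_from_subtopology_mono[OF continuous_map_q_division])
       (auto simp: M_def subgroup.m_closed subgroup.m_inv_closed)
  then have "continuous_map (prod_topology (subtopology T L) (subtopology T L)) P (\<lambda>(x, z). q (inv x \<otimes> z))"
    by (simp add: subtopology_Times)
  then have "continuous_map (prod_topology (subtopology T L) (subtopology T L)) P
      (\<lambda>(x, z). q (inv\<^bsub>G\<lparr>carrier := L\<rparr>\<^esub> x \<otimes> z))"
    by (rule continuous_map_eq) (use subgroup_L in auto)
  then show ?thesis
    using LT.topological_group_coset[OF normal_N] coset_topology_eq
    by (simp add: coset_topology_def)
qed

subsection \<open>The action on \<open>G/N\<close>\<close>

abbreviation GN :: "'a set topology"
  where "GN \<equiv> coset_topology G T N"

text \<open>\<open>N\<close> is \<sigma>-closed in \<open>G\<close> because \<open>L\<close> is, so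
  division pulls its complement back to an open set of pairs; a rectangle inside that set separates
  the cosets.\<close>

lemma Hausdorff_space_GN: "Hausdorff_space GN"
proof (rule Hausdorff_space_coset[OF subgroup_N])
  let ?d = "\<lambda>(x, y). inv x \<otimes> y"
  have "closedin \<sigma> N"
    using closedin_N closedin_L by (rule closedin_trans_full)
  then have "openin \<sigma> (topspace \<sigma> - N)"
    by (simp add: openin_diff)
  then have *: "openin (prod_topology T T) {z \<in> topspace (prod_topology T T). ?d z \<in> topspace \<sigma> - N}"
    by (rule openin_continuous_map_preimage[OF continuous_map_division])
  fix x y assume xy: "x \<in> carrier G" "y \<in> carrier G" "inv x \<otimes> y \<notin> N"
  then have "(x, y) \<in> {z \<in> topspace (prod_topology T T). ?d z \<in> topspace \<sigma> - N}"
    by (simp add: topspace_eq topspace_sigma)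
  then obtain U V where UV: "openin T U" "openin T V" "x \<in> U" "y \<in> V"
      "U \<times> V \<subseteq> {z \<in> topspace (prod_topology T T). ?d z \<in> topspace \<sigma> - N}"
    using * unfolding openin_prod_topology_alt by meson
  have "\<forall>u\<in>U. \<forall>v\<in>V. inv u \<otimes> v \<notin> N"
    using UV(5) by fastforce
  then show "\<exists>U V. openin T U \<and> openin T V \<and> x \<in> U \<and> y \<in> V \<and> (\<forall>u\<in>U. \<forall>v\<in>V. inv u \<otimes> v \<notin> N)"
    using UV(1-4) by (intro exI conjI)
qed

text \<open>With \<open>z = x \<otimes> y\<close> the value is the argument ([x], [y]) of the
  action, while [z] is its result. Compact sets of pairs thus give compact sets of
  arguments.\<close>

lemma continuous_map_translation_graph:
  "continuous_map (subtopology (prod_topology T T) M) (prod_topology GN P)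
     (\<lambda>(x, z). (q x, q (inv x \<otimes> z)))"
proof -
  have "continuous_map (subtopology (prod_topology T T) M) GN (q \<circ> fst)"
    by (intro continuous_map_from_subtopology continuous_map_compose[OF continuous_map_fst continuous_map_coset])
  then show ?thesis
    using continuous_map_pairedI[OF _ continuous_map_q_division] by (simp add: o_def case_prod_unfold)
qed

lemma compactin_fibre_image:
  assumes "compactin T A" "compactin T C" "closedin T B"
  shows "compactin (subtopology (prod_topology T T) M) ((A \<times> (C \<inter> B)) \<inter> M)"
proof -
  have "compactin (prod_topology T T) (A \<times> (C \<inter> B))"
    using assms by (simp add: compactin_Times compact_Int_closedin)
  then show ?thesis
    by (simp add: compactin_subtopology compact_Int_closedin[OF _ closedin_M])
qed

lemma mult_inv_cancel:
  assumes "(x, z) \<in> M"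
  shows "q x <#> q (inv x \<otimes> z) = q z"
proof -
  have "x \<in> carrier G" "z \<in> carrier G" "inv x \<otimes> z \<in> L"
    using assms by (auto simp: M_def)
  then show ?thesis
    by (simp add: q_set_mult m_assoc[symmetric])
qed

text \<open>Right translates of a compact set \<open>A\<close> are compact, so \<open>A \<otimes> y\<close> lies in a member \<open>C\<close> of a
  countable exhaustion; by Baire the same \<open>C\<close> serves for all \<open>y\<close> in an open set, modulo \<open>N\<close>.\<close>
lemma bounded_on_open_set:
  assumes A: "compactin T A" "A \<noteq> {}"
  shows "\<exists>C V. compactin T C \<and> openin P V \<and> V \<noteq> {} \<and>
    (\<forall>a\<in>A. \<forall>r\<in>V. \<exists>z\<in>C. (a, z) \<in> M \<and> r = q (inv a \<otimes> z))"
proof -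
  obtain \<C> where \<C>: "countable \<C>" "\<forall>C\<in>\<C>. compactin T C"
      "\<forall>A. compactin T A \<longrightarrow> (\<exists>C\<in>\<C>. A \<subseteq> C)"
    using sigma_compact_exhaustion[OF Hausdorff locally_compact sigma_compact] by (elim exE conjE)
  \<comment> \<open>\<open>D a C\<close> collects the classes having a representative
    \<open>y\<close> with \<open>a \<otimes> y\<close> in \<open>C\<close>. \<open>F C\<close>
    requires this for all \<open>a\<close> in \<open>A\<close>, where \<open>y\<close> may depend on
    \<open>a\<close>.\<close>
  define D where "D a C = (\<lambda>(x, z). q (inv x \<otimes> z)) ` (({a} \<times> C) \<inter> M)" for a C
  define F where "F C = (\<Inter>a\<in>A. D a C)" for C
  have AG: "A \<subseteq> carrier G"
    using A compactin_subset_topspace topspace_eq by blast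
  have "closedin P (D a C)" if "a \<in> A" "C \<in> \<C>" for a C
  proof -
    have "compactin (subtopology (prod_topology T T) M) (({a} \<times> (C \<inter> topspace T)) \<inter> M)"
      using that AG \<C>(2) by (intro compactin_fibre_image closedin_topspace) (auto simp: topspace_eq)
    moreover have "C \<inter> topspace T = C"
      using bspec[OF \<C>(2) that(2)] compactin_subset_topspace by blast
    ultimately show ?thesis
      unfolding D_def
      by (intro compactin_imp_closedin[OF Hausdorff_quotient] image_compactin[OF _ continuous_map_q_division]) simp
  qed
  \<comment> \<open>As \<open>A\<close> is nonempty, the intersection is over a nonempty
    family.\<close>
  then have F: "closedin P (F C)" if "C \<in> \<C>" for C
    using A(2) that unfolding F_def by (intro closedin_Inter) auto
  have "topspace P \<subseteq> \<Union>(F ` \<C>)"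
  proof
    fix r assume "r \<in> topspace P"
    then obtain y where y: "y \<in> L" "r = q y"
      unfolding topspace_P by (elim imageE)
    then have yG: "y \<in> carrier G"
      using L_subset by blast
    obtain C where C: "C \<in> \<C>" "(\<lambda>a. a \<otimes> y) ` A \<subseteq> C"
      using \<C>(3)[rule_format, OF image_compactin[OF A(1) continuous_right_mult[OF yG]]] by (elim bexE)
    have "r \<in> D a C" if "a \<in> A" for a
    proof -
      have a: "a \<in> carrier G" "inv a \<otimes> (a \<otimes> y) = y"
        using that AG yG by (auto simp: m_assoc[symmetric])
      then have "(a, a \<otimes> y) \<in> ({a} \<times> C) \<inter> M"
        using that C(2) y yG by (auto simp: M_def)
      then show ?thesis
        unfolding D_def by (rule rev_image_eqI) (simp add: a y)
    qed
    then have "r \<in> F C"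
      by (simp add: F_def)
    with C(1) show "r \<in> \<Union>(F ` \<C>)"
      by (rule UN_I)
  qed
  moreover have "\<Union>(F ` \<C>) \<subseteq> topspace P"
    using closedin_subset[OF F] by (rule UN_least)
  ultimately have cover: "\<Union>(F ` \<C>) = topspace P"
    by (rule subset_antisym[rotated])
  obtain X where X: "X \<in> F ` \<C>" "P interior_of X \<noteq> {}"
    by (rule Baire_quotient[OF countable_image[OF \<C>(1), of F] _ cover]) (use F in auto)
  obtain C where C: "X = F C" "C \<in> \<C>"
    using X(1) by (rule imageE)
  show ?thesis
  proof (intro exI conjI ballI)
    show "compactin T C"
      using \<C>(2) C(2) by (rule bspec)
    show "openin P (P interior_of X)"
      by simp
    show "P interior_of X \<noteq> {}"
      by (rule X(2))
    fix a r assume ar: "a \<in> A" "r \<in> P interior_of X"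
    have "r \<in> X"
      using ar(2) interior_of_subset by (rule subsetD[rotated])
    then have "r \<in> D a C"
      using ar(1) unfolding C(1) F_def by simp
    then show "\<exists>z\<in>C. (a, z) \<in> M \<and> r = q (inv a \<otimes> z)"
      unfolding D_def by auto
  qed
qed

text \<open>Continuity into a compact set follows from closedness of the graph.\<close>
lemma local_joint_continuity:
  assumes x: "x \<in> carrier G"
  shows "\<exists>O' V. openin GN O' \<and> q x \<in> O' \<and> openin P V \<and> V \<noteq> {} \<and>
    (\<forall>W. openin GN W \<longrightarrow> openin (prod_topology GN P) {(p, r) \<in> O' \<times> V. p <#> r \<in> W})"
proof -
  obtain A0 A where A: "openin T A0" "compactin T A" "x \<in> A0" "A0 \<subseteq> A"
    using locally_compact x unfolding locally_compact_space_def topspace_eq by meson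
  then have "A \<noteq> {}" by auto
  obtain C V where C: "compactin T C" and V: "openin P V" "V \<noteq> {}"
    and CV: "\<forall>a\<in>A. \<forall>r\<in>V. \<exists>z\<in>C. (a, z) \<in> M \<and> r = q (inv a \<otimes> z)"
    using bounded_on_open_set[OF A(2) \<open>A \<noteq> {}\<close>] by (elim exE conjE)
  let ?f = "\<lambda>(x, z). (q x, q (inv x \<otimes> z))"
  have A0: "openin GN (q ` A0)"
    using open_map_coset[OF subgroup_N] A(1) by (simp add: open_map_def)
  have "openin (prod_topology GN P) {(p, r) \<in> q ` A0 \<times> V. p <#> r \<in> W}" if W: "openin GN W" for W
  proof -
    define B where "B = topspace T - {z \<in> topspace T. q z \<in> W}"
    have "closedin T B"
      unfolding B_def
      by (intro closedin_diff closedin_topspace openin_continuous_map_preimage[OF continuous_map_coset W])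
    \<comment> \<open>The image of \<open>K\<close> under \<open>?f\<close> is compact, hence
      closed. Over \<open>A0\<close> and \<open>V\<close> it consists exactly of the arguments whose
      product lies outside \<open>W\<close>.\<close>
    define K where "K = (A \<times> (C \<inter> B)) \<inter> M"
    have "compactin (prod_topology GN P) (?f ` K)"
      unfolding K_def
      by (intro image_compactin[OF compactin_fibre_image continuous_map_translation_graph] A C \<open>closedin T B\<close>)
    then have "closedin (prod_topology GN P) (?f ` K)"
      by (rule compactin_imp_closedin[rotated])
         (simp add: Hausdorff_space_prod_topology Hausdorff_space_GN Hausdorff_quotient)
    moreover have "openin (prod_topology GN P) (q ` A0 \<times> V)"
      using A0 V(1) by (simp add: openin_prod_Times_iff)
    ultimately have "openin (prod_topology GN P) (q ` A0 \<times> V - ?f ` K)"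
      by (intro openin_diff)
    \<comment> \<open>One inclusion needs \<open>CV\<close>, which supplies a witness
      \<open>z\<close> in the compact set \<open>C\<close>. The other holds because the product
      depends only on the two cosets.\<close>
    moreover have "q ` A0 \<times> V - ?f ` K = {(p, r) \<in> q ` A0 \<times> V. p <#> r \<in> W}"
    proof (intro equalityI subsetI)
      fix pr assume pr: "pr \<in> q ` A0 \<times> V - ?f ` K"
      then obtain a r where ar: "pr = (q a, r)" "a \<in> A0" "r \<in> V"
        by auto
      then obtain z where z: "z \<in> C" "(a, z) \<in> M" "r = q (inv a \<otimes> z)"
        using CV A(4) by blast
      have "q z \<in> W"
      proof (rule ccontr)
        assume "q z \<notin> W"
        moreover have "z \<in> topspace T"
          using z(2) by (simp add: M_def topspace_eq)
        ultimately have "(a, z) \<in> K"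
          using z ar(2) A(4) by (auto simp: K_def B_def)
        then have "pr \<in> ?f ` K"
          by (rule rev_image_eqI) (simp add: ar z)
        then show False
          using pr by simp
      qed
      then show "pr \<in> {(p, r) \<in> q ` A0 \<times> V. p <#> r \<in> W}"
        using ar z mult_inv_cancel[OF z(2)] by simp
    next
      fix pr assume pr: "pr \<in> {(p, r) \<in> q ` A0 \<times> V. p <#> r \<in> W}"
      have "pr \<notin> ?f ` K"
      proof
        assume "pr \<in> ?f ` K"
        then obtain b z where bz: "(b, z) \<in> K" "pr = (q b, q (inv b \<otimes> z))"
          by auto
        then have "q z \<notin> W" "(b, z) \<in> M"
          by (auto simp: K_def B_def)
        then show False
          using pr mult_inv_cancel unfolding bz(2) by simp
      qed
      then show "pr \<in> q ` A0 \<times> V - ?f ` K"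
        using pr by auto
    qed
    ultimately show ?thesis
      by simp
  qed
  moreover have "q x \<in> q ` A0"
    using A(3) by simp
  ultimately show ?thesis
    using A0 V by (intro exI[of _ "q ` A0"] exI[of _ V]) simp
qed

text \<open>\<open>local_joint_continuity\<close> gives an open \<open>V\<close> somewhere in
  \<open>P\<close>, possibly far from the class of \<open>y\<close>. Right translation by a suitable
  \<open>g\<close> moves that class into \<open>V\<close>, and translation by \<open>inv g\<close>
  moves the product back.\<close>

lemma continuous_map_coset_mult: "continuous_map (prod_topology GN P) GN (\<lambda>(p, r). p <#> r)"
  unfolding continuous_map_def
proof (intro conjI allI impI)
  show "(\<lambda>(p, r). p <#> r) \<in> topspace (prod_topology GN P) \<rightarrow> topspace GN"
    using L_subset by (auto simp: topspace_coset topspace_P q_set_mult subset_iff)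
  fix W assume W: "openin GN W"
  show "openin (prod_topology GN P) {z \<in> topspace (prod_topology GN P). (\<lambda>(p, r). p <#> r) z \<in> W}"
    (is "openin _ ?S")
  proof (subst openin_subopen, intro ballI)
    fix z assume "z \<in> ?S"
    then obtain x y where xy: "x \<in> carrier G" "y \<in> L" "z = (q x, q y)" "q (x \<otimes> y) \<in> W"
      by (auto simp: topspace_coset topspace_P q_set_mult)
    obtain O' V where OV: "openin GN O'" "q x \<in> O'" "openin P V" "V \<noteq> {}"
      and cont: "\<forall>W. openin GN W \<longrightarrow> openin (prod_topology GN P) {(p, r) \<in> O' \<times> V. p <#> r \<in> W}"
      using local_joint_continuity[OF xy(1)] by (elim exE conjE)
    obtain y1 where y1: "y1 \<in> L" "q y1 \<in> V"
      using OV(4) openin_subset[OF OV(3)] unfolding topspace_P by blast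
    define g where "g = inv y \<otimes> y1"
    have g: "g \<in> L" "inv g \<in> L"
      using xy y1 subgroup_L by (auto simp: g_def subgroup.m_closed subgroup.m_inv_closed)
    have carr: "g \<in> carrier G" "y \<in> carrier G" "y1 \<in> carrier G"
      using g xy y1 L_subset by auto
    have yg: "y \<otimes> g = y1"
      using carr by (simp add: g_def m_assoc[symmetric])
    define W' where "W' = {p \<in> topspace GN. p #> inv g \<in> W}"
    have "openin GN W'"
      unfolding W'_def
      using continuous_map_r_coset[of "inv g" T] continuous_right_mult[of "inv g"] g carr
      by (intro openin_continuous_map_preimage[OF _ W]) (auto simp: topspace_eq)
    then have "openin (prod_topology GN P) {(p, r) \<in> O' \<times> V. p <#> r \<in> W'}"
      by (rule cont[rule_format])
    moreover have "continuous_map (prod_topology GN P) (prod_topology GN P) (\<lambda>(p, r). (p, r #> g))"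
      using continuous_map_r_coset_P[OF g(1)] by (auto simp: continuous_map_prod_top)
    ultimately have open': "openin (prod_topology GN P) {z \<in> topspace (prod_topology GN P).
        (\<lambda>(p, r). (p, r #> g)) z \<in> {(p, r) \<in> O' \<times> V. p <#> r \<in> W'}}" (is "openin _ ?S'")
      by (rule openin_continuous_map_preimage[rotated])
    \<comment> \<open>By associativity, translating the second argument by \<open>g\<close>
      translates the product by \<open>g\<close>, which \<open>W'\<close> undoes.\<close>
    have shift: "q a <#> (q b #> g) \<in> W' \<longleftrightarrow> q a <#> q b \<in> W" if "a \<in> carrier G" "b \<in> L" for a b
    proof -
      have b: "b \<in> carrier G" "b \<otimes> g \<in> L"
        using that g L_subset subgroup_L by (auto simp: subgroup.m_closed)
      have "q a <#> (q b #> g) = q (a \<otimes> (b \<otimes> g))"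
        using that b g by (simp add: q_r_coset q_set_mult)
      moreover have "q (a \<otimes> (b \<otimes> g)) #> inv g = q (a \<otimes> b)"
        using that b g carr by (simp add: q_r_coset m_assoc)
      ultimately show ?thesis
        using that b carr by (auto simp: W'_def topspace_coset q_set_mult)
    qed
    have "z \<in> ?S'"
      using xy OV(2) y1 shift[OF xy(1,2)] g yg
      by (auto simp: topspace_coset topspace_P q_set_mult q_r_coset carr)
    moreover have "?S' \<subseteq> ?S"
      by (auto simp: topspace_coset topspace_P shift)
    ultimately show "\<exists>U. openin (prod_topology GN P) U \<and> z \<in> U \<and> U \<subseteq> ?S"
      using open' by (intro exI[of _ ?S'] conjI)
  qed
qed

end

section \<open>Application to N(L) and the three assertions\<close>

theorem proposition2p3:
  fixes G :: "('a, 'b) monoid_scheme" and \<tau> :: "'a topology" and L :: "'a set"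
  assumes "right_topological_group G \<tau>"
    and "Hausdorff_space \<tau>"
    and "compact_space \<tau> \<or>
         (locally_compact_space \<tau> \<and> sigma_compact_space \<tau> \<and> admissible G \<tau>)"
    and "subgroup L G"
    and "closedin (sigma_topology G \<tau>) L"
  shows "let \<sigma> = sigma_topology G \<tau>;
             N = N_sub G \<tau> L;
             G_N = coset_topology G \<tau> N;
             L_N = coset_topology G (subtopology \<tau> L) N
         in (N \<lhd> G\<lparr>carrier := L\<rparr> \<and> closedin (subtopology \<sigma> L) N) \<and>
            (L_N = coset_topology G (subtopology \<sigma> L) N \<and>
             sigma_compact_space L_N \<and> Hausdorff_space L_N \<and>
             topological_group (G\<lparr>carrier := L\<rparr> LMod N) L_N) \<and>
            (\<exists>m. (\<forall>x\<in>carrier G. \<forall>y\<in>L.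
                   m (x <#\<^bsub>G\<^esub> N, y <#\<^bsub>G\<^esub> N) = (x \<otimes>\<^bsub>G\<^esub> y) <#\<^bsub>G\<^esub> N) \<and>
                 continuous_map (prod_topology G_N L_N) G_N m)"
proof -
  interpret right_topological_group G \<tau> by fact
  interpret S: quasitopological_group G "sigma_topology G \<tau>"
    by (rule quasitopological_group_sigma)
  interpret LS: quasitopological_group "G\<lparr>carrier := L\<rparr>" "subtopology (sigma_topology G \<tau>) L"
    using assms(4) by (rule S.subgroup_quasitopological_group)
  define N where "N = N_sub G \<tau> L"
  have N: "N = LS.core"
    by (simp add: N_def N_sub_def LS.core_def Let_def)
  interpret Q: sigma_closed_subgroup_quotient G \<tau> L N
  proof (intro sigma_closed_subgroup_quotient.intro sigma_closed_subgroup_quotient_axioms.intro)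
    show "N \<lhd> G\<lparr>carrier := L\<rparr>"
      unfolding N by (rule LS.normal_core)
    show "closedin (subtopology (sigma_topology G \<tau>) L) N"
      unfolding N by (rule LS.closedin_core)
    show "Hausdorff_space (coset_topology G (subtopology (sigma_topology G \<tau>) L) N)"
      using LS.Hausdorff_space_coset_core unfolding N by (simp add: coset_topology_def)
  qed (rule assms)+
  have "\<exists>m. (\<forall>x\<in>carrier G. \<forall>y\<in>L.
        m (x <#\<^bsub>G\<^esub> N, y <#\<^bsub>G\<^esub> N) = (x \<otimes>\<^bsub>G\<^esub> y) <#\<^bsub>G\<^esub> N) \<and>
      continuous_map (prod_topology Q.GN Q.P) Q.GN m"
    using Q.q_set_mult Q.continuous_map_coset_mult
    \<comment> \<open>The witness is the product of subsets, which \<open>q_set_mult\<close>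
      evaluates on cosets.\<close>
    by (intro exI[of _ "\<lambda>(p, r). p <#>\<^bsub>G\<^esub> r"]) simp
  then show ?thesis
    using Q.normal_N Q.closedin_N Q.sigma_compact_space_P Q.Hausdorff_quotient Q.topological_group_P
    unfolding Let_def N_def[symmetric] Q.coset_topology_eq by (intro conjI refl)
qed

end
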